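(* Let $n\ge 2$, let $P=(p_1,\dots,p_n)$ and $Q=(q_1,\dots,q_n)$ be elements of $\Gamma_n$, and let $r,R$ be real numbers with $0<r\le \frac{p_i}{q_i}\le R<\infty$ for all $i\in\{1,\dots,n\}$. Then $$\frac{(R+1)^2}{16R^2}\,\Delta(P\|Q)\le G(P\|Q)\le \frac{(r+1)^2}{16r^2}\,\Delta(P\|Q).$$
   Context: $\Gamma_n=\{P=(p_1,\dots,p_n): p_i>0,\ \sum_{i=1}^n p_i=1\}$ is the set of finite discrete probability distributions with strictly positive entries. $\ln$ is the natural logarithm. The relative arithmetic-geometric divergence is $G(P\|Q)=\sum_{i=1}^n \left(\frac{p_i+q_i}{2}\right)\ln\left(\frac{p_i+q_i}{2p_i}\right)$. The triangular discrimination is $\Delta(P\|Q)=\sum_{i=1}^n \frac{(p_i-q_i)^2}{p_i+q_i}$. *)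

theory Defs
  imports "HOL-Analysis.Analysis"
begin

text \<open>Probability distributions on \<open>n\<close> points are vectors in \<^typ>\<open>real ^ 'n\<close>
  with \<open>n = CARD('n)\<close>.\<close>

definition Gamma_simplex :: "(real ^ 'n) set"
  where "Gamma_simplex = {P. (\<forall>i. P $ i > 0) \<and> (\<Sum>i\<in>UNIV. P $ i) = 1}"

definition ag_divergence :: "real ^ 'n \<Rightarrow> real ^ 'n \<Rightarrow> real"
  where "ag_divergence P Q =
    (\<Sum>i\<in>UNIV. (P $ i + Q $ i) / 2 * ln ((P $ i + Q $ i) / (2 * P $ i)))"

definition triangular_discrimination :: "real ^ 'n \<Rightarrow> real ^ 'n \<Rightarrow> real"
  where "triangular_discrimination P Q =
    (\<Sum>i\<in>UNIV. (P $ i - Q $ i)\<^sup>2 / (P $ i + Q $ i))"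

end

theory Submission imports Defs begin

text \<open>Both divergences are \<open>\<Sum>\<^sub>i q\<^sub>i f(p\<^sub>i/q\<^sub>i)\<close>, with generators whose second derivatives have
  the quotient \<open>(x + 1)\<^sup>2 / (16 x\<^sup>2)\<close>. This is decreasing in \<open>x\<close>, so on \<open>[r, R]\<close>, an interval that
  contains \<open>1\<close>, it lies between its values at \<open>R\<close> and at \<open>r\<close>. Comparing both functions with their
  tangents at \<open>1\<close> turns this into an inequality between the generators up to a multiple of
  \<open>x - 1\<close>, whose contribution to the sum vanishes because \<open>\<Sum>\<^sub>i (p\<^sub>i - q\<^sub>i) = 0\<close>.\<close>

text \<open>The summand \<open>(x - 1) / 2\<close> makes the derivative vanish at \<open>1\<close>,
  so that \<open>ag_gen\<close> and \<open>tri_gen\<close> agree there in value (\<open>0\<close>)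
  and in slope (\<open>0\<close>).\<close>

definition ag_gen :: "real \<Rightarrow> real"
  where "ag_gen x = (x + 1) / 2 * ln ((x + 1) / (2 * x)) + (x - 1) / 2"

definition tri_gen :: "real \<Rightarrow> real"
  where "tri_gen x = (x - 1)\<^sup>2 / (x + 1)"

text \<open>The difference \<open>g - f\<close> is convex on \<open>C\<close>, hence lies above its
  tangent at \<open>a\<close>, and that tangent is zero.\<close>

lemma le_from_second_deriv_le:
  fixes f g :: "real \<Rightarrow> real"
  assumes "convex C" and "a \<in> C" and "x \<in> C"
    and f': "\<And>y. y \<in> C \<Longrightarrow> (f has_real_derivative f' y) (at y)"
    and f'': "\<And>y. y \<in> C \<Longrightarrow> (f' has_real_derivative f'' y) (at y)"
    and g': "\<And>y. y \<in> C \<Longrightarrow> (g has_real_derivative g' y) (at y)"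
    and g'': "\<And>y. y \<in> C \<Longrightarrow> (g' has_real_derivative g'' y) (at y)"
    and le: "\<And>y. y \<in> C \<Longrightarrow> f'' y \<le> g'' y"
    and "f a = g a" and "f' a = g' a"
  shows "f x \<le> g x"
proof -
  have "(g' a - f' a) * (x - a) \<le> (g x - f x) - (g a - f a)"
    using assms(1-3) le
    by (intro f''_imp_f'[where C = C and f = "\<lambda>y. g y - f y" and f' = "\<lambda>y. g' y - f' y"
          and f'' = "\<lambda>y. g'' y - f'' y"] DERIV_diff f' f'' g' g'') auto
  with assms show ?thesis by simp
qed

lemma ag_gen_deriv:
  assumes "x > 0"
  shows "(ag_gen has_real_derivative ln ((x + 1) / (2 * x)) / 2 - 1 / (2 * x) + 1 / 2) (at x)"
proof -
  have "x + 1 \<noteq> 0" "x \<noteq> 0" using assms by auto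
  then show ?thesis
    unfolding ag_gen_def using assms
    by (auto intro!: derivative_eq_intros)
qed

lemma ag_gen_deriv2:
  fixes x :: real
  assumes "x > 0"
  shows "((\<lambda>x. ln ((x + 1) / (2 * x)) / 2 - 1 / (2 * x) + 1 / 2)
    has_real_derivative 1 / (2 * x\<^sup>2 * (x + 1))) (at x)"
proof -
  have "x + 1 \<noteq> 0" "x \<noteq> 0" using assms by auto
  then show ?thesis
    using assms
    by (auto intro!: derivative_eq_intros) (auto simp: divide_simps, algebra)
qed

text \<open>The form of the derivative comes from
  \<open>tri_gen x = x - 3 + 4 / (x + 1)\<close>.\<close>

lemma tri_gen_deriv:
  assumes "x > 0"
  shows "(tri_gen has_real_derivative 1 - 4 / (x + 1)\<^sup>2) (at x)"
proof -
  have "x + 1 \<noteq> 0" using assms by auto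
  then show ?thesis
    unfolding tri_gen_def
    by (auto intro!: derivative_eq_intros) (auto simp: divide_simps, algebra)
qed

lemma tri_gen_deriv2:
  fixes x :: real
  assumes "x > 0"
  shows "((\<lambda>x. 1 - 4 / (x + 1)\<^sup>2) has_real_derivative 8 / (x + 1) ^ 3) (at x)"
proof -
  have "x + 1 \<noteq> 0" using assms by auto
  then show ?thesis
    by (auto intro!: derivative_eq_intros) (auto simp: divide_simps, algebra)
qed

text \<open>Up to the factor \<open>1 / 16\<close> both sides are squares of
  \<open>1 + 1 / t\<close>, which decreases for positive \<open>t\<close>.\<close>

lemma second_deriv_ratio_antimono:
  fixes x y :: real
  assumes "0 < x" and "x \<le> y"
  shows "(y + 1)\<^sup>2 / (16 * y\<^sup>2) \<le> (x + 1)\<^sup>2 / (16 * x\<^sup>2)"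
proof -
  have "(y + 1) / y \<le> (x + 1) / x" using assms by (simp add: field_simps)
  then have "((y + 1) / y)\<^sup>2 \<le> ((x + 1) / x)\<^sup>2" using assms by (intro power_mono) auto
  then show ?thesis by (simp add: power_divide)
qed

text \<open>Splitting off the second derivative of \<open>tri_gen\<close> as a positive factor
  reduces the comparison of second derivatives to the monotonicity of the quotient.\<close>

lemma second_deriv_eq:
  fixes x :: real
  assumes "x > 0"
  shows "1 / (2 * x\<^sup>2 * (x + 1)) = (x + 1)\<^sup>2 / (16 * x\<^sup>2) * (8 / (x + 1) ^ 3)"
proof -
  have "x + 1 \<noteq> 0" "x \<noteq> 0" using assms by auto
  then show ?thesis by (simp add: divide_simps) algebra
qed

text \<open>On \<open>{0<..R}\<close> the quotient of the second derivatives is smallest at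
  \<open>R\<close>; the assumption \<open>1 \<le> R\<close> puts the tangent point \<open>1\<close>
  into this interval.\<close>

lemma gen_lower:
  assumes "0 < x" and "x \<le> R" and "1 \<le> R"
  shows "(R + 1)\<^sup>2 / (16 * R\<^sup>2) * tri_gen x \<le> ag_gen x"
proof (rule le_from_second_deriv_le[where C = "{0<..R}" and a = 1,
      OF _ _ _ DERIV_cmult[OF tri_gen_deriv] DERIV_cmult[OF tri_gen_deriv2]
      ag_gen_deriv ag_gen_deriv2])
  show "(R + 1)\<^sup>2 / (16 * R\<^sup>2) * (8 / (y + 1) ^ 3) \<le> 1 / (2 * y\<^sup>2 * (y + 1))"
    if "y \<in> {0<..R}" for y
    using that mult_right_mono[OF second_deriv_ratio_antimono[of y R], of "8 / (y + 1) ^ 3"]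
    by (auto simp: second_deriv_eq)
qed (use assms in \<open>auto simp: ag_gen_def tri_gen_def\<close>)

text \<open>Dually, on \<open>{r..}\<close> the quotient is largest at \<open>r\<close>, and
  \<open>r \<le> 1\<close> puts the tangent point into the interval.\<close>

lemma gen_upper:
  assumes "0 < r" and "r \<le> x" and "r \<le> 1"
  shows "ag_gen x \<le> (r + 1)\<^sup>2 / (16 * r\<^sup>2) * tri_gen x"
proof (rule le_from_second_deriv_le[where C = "{r..}" and a = 1,
      OF _ _ _ ag_gen_deriv ag_gen_deriv2
      DERIV_cmult[OF tri_gen_deriv] DERIV_cmult[OF tri_gen_deriv2]])
  show "1 / (2 * y\<^sup>2 * (y + 1)) \<le> (r + 1)\<^sup>2 / (16 * r\<^sup>2) * (8 / (y + 1) ^ 3)"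
    if "y \<in> {r..}" for y
    using that assms mult_right_mono[OF second_deriv_ratio_antimono[of r y], of "8 / (y + 1) ^ 3"]
    by (auto simp: second_deriv_eq)
qed (use assms in \<open>auto simp: ag_gen_def tri_gen_def\<close>)

lemma ag_divergence_gen:
  assumes "P \<in> Gamma_simplex" and "Q \<in> Gamma_simplex"
  shows "ag_divergence P Q = (\<Sum>i\<in>UNIV. Q $ i * ag_gen (P $ i / Q $ i))"
proof -
  have "Q $ i * ag_gen (P $ i / Q $ i) =
      (P $ i + Q $ i) / 2 * ln ((P $ i + Q $ i) / (2 * P $ i)) + (P $ i - Q $ i) / 2" for i
  proof -
    have "P $ i > 0" "Q $ i > 0" using assms by (auto simp: Gamma_simplex_def)
    then have arg: "(P $ i / Q $ i + 1) / (2 * (P $ i / Q $ i)) = (P $ i + Q $ i) / (2 * P $ i)"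
      and "Q $ i * ((P $ i / Q $ i + 1) / 2) = (P $ i + Q $ i) / 2"
      and "Q $ i * ((P $ i / Q $ i - 1) / 2) = (P $ i - Q $ i) / 2"
      by (simp_all add: field_simps)
    then show ?thesis
      unfolding ag_gen_def arg by (simp only: distrib_left mult.assoc[symmetric])
  qed
  \<comment> \<open>The extra terms \<open>(P $ i - Q $ i) / 2\<close> cancel in the sum, since
    \<open>P\<close> and \<open>Q\<close> have the same total mass.\<close>
  then show ?thesis
    using assms
    by (simp add: ag_divergence_def Gamma_simplex_def sum.distrib sum_subtractf
        flip: sum_divide_distrib)
qed

lemma triangular_discrimination_gen:
  assumes "P \<in> Gamma_simplex" and "Q \<in> Gamma_simplex"
  shows "triangular_discrimination P Q = (\<Sum>i\<in>UNIV. Q $ i * tri_gen (P $ i / Q $ i))"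
  unfolding triangular_discrimination_def
proof (rule sum.cong[OF refl])
  fix i
  have "P $ i > 0" "Q $ i > 0" using assms by (auto simp: Gamma_simplex_def)
  moreover from this have "P $ i / Q $ i - 1 = (P $ i - Q $ i) / Q $ i"
    "P $ i / Q $ i + 1 = (P $ i + Q $ i) / Q $ i"
    by (auto simp: field_simps)
  ultimately show "(P $ i - Q $ i)\<^sup>2 / (P $ i + Q $ i) = Q $ i * tri_gen (P $ i / Q $ i)"
    unfolding tri_gen_def by (simp add: power_divide power2_eq_square)
qed

theorem proposition6p1:
  fixes P Q :: "real ^ 'n" and r R :: real
  assumes "CARD('n) \<ge> 2"
    and "P \<in> Gamma_simplex" and "Q \<in> Gamma_simplex"
    and "0 < r"
    and "\<And>i. r \<le> P $ i / Q $ i" and "\<And>i. P $ i / Q $ i \<le> R"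
  shows "(R + 1)\<^sup>2 / (16 * R\<^sup>2) * triangular_discrimination P Q \<le> ag_divergence P Q
    \<and> ag_divergence P Q \<le> (r + 1)\<^sup>2 / (16 * r\<^sup>2) * triangular_discrimination P Q"
proof -
  have pos: "P $ i > 0" "Q $ i > 0" for i
    using assms by (auto simp: Gamma_simplex_def)
  have sums: "(\<Sum>i\<in>UNIV. P $ i) = 1" "(\<Sum>i\<in>UNIV. Q $ i) = 1"
    using assms by (auto simp: Gamma_simplex_def)
  \<comment> \<open>The \<open>Q\<close>-weighted mean of the ratios \<open>P $ i / Q $ i\<close> is
    \<open>1\<close>, so their bounds \<open>r\<close> and \<open>R\<close> enclose
    \<open>1\<close>.\<close>
  have "(\<Sum>i\<in>UNIV. r * Q $ i) \<le> (\<Sum>i\<in>UNIV. P $ i)"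
    using assms(5) pos by (intro sum_mono) (simp add: pos_le_divide_eq)
  then have r: "r \<le> 1" by (simp add: sums flip: sum_distrib_left)
  have "(\<Sum>i\<in>UNIV. P $ i) \<le> (\<Sum>i\<in>UNIV. R * Q $ i)"
    using assms(6) pos by (intro sum_mono) (simp add: pos_divide_le_eq)
  then have R: "1 \<le> R" by (simp add: sums flip: sum_distrib_left)
  have lower: "(R + 1)\<^sup>2 / (16 * R\<^sup>2) * (Q $ i * tri_gen (P $ i / Q $ i))
      \<le> Q $ i * ag_gen (P $ i / Q $ i)" for i
    using mult_left_mono[OF gen_lower[OF _ assms(6) R], of i "Q $ i"] pos[of i]
    by (simp add: mult.left_commute)
  have upper: "Q $ i * ag_gen (P $ i / Q $ i)
      \<le> (r + 1)\<^sup>2 / (16 * r\<^sup>2) * (Q $ i * tri_gen (P $ i / Q $ i))" for i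
    using mult_left_mono[OF gen_upper[OF assms(4,5) r], of "Q $ i" i] pos[of i]
    by (simp add: mult.left_commute)
  show ?thesis
    unfolding ag_divergence_gen[OF assms(2,3)] triangular_discrimination_gen[OF assms(2,3)]
      sum_distrib_left
    by (intro conjI sum_mono lower upper)
qed

end
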